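(* Let $T$ be a bounded linear operator on a complex Hilbert space which is coquasiposinormal. If $T$ is paranormal and $T^n$ is quasinormal for some positive integer $n$, then $T$ is normal.
   Context: $T$ is coquasiposinormal if $\mathcal{N}(T^* )\subseteq\mathcal{N}(T)$ (equivalently $\overline{\mathcal{R}(T^* )}\subseteq\overline{\mathcal{R}(T)}$), where $\mathcal{N}$ and $\mathcal{R}$ denote kernel and range. $T$ is paranormal if $\|Tx\|^2\le\|T^2x\|\,\|x\|$ for every vector $x$. An operator $A$ is quasinormal if $(A^*A-AA^* )A=O$. *)

theory Defs
  imports "HOL-Analysis.Analysis"
begin

class complex_hilbert = real_normed_vector + complete_space +
  fixes scaleC :: "complex \<Rightarrow> 'a \<Rightarrow> 'a"
    and cinner :: "'a \<Rightarrow> 'a \<Rightarrow> complex"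
  assumes scaleC_add_right: "scaleC a (x + y) = scaleC a x + scaleC a y"
    and scaleC_add_left: "scaleC (a + b) x = scaleC a x + scaleC b x"
    and scaleC_scaleC: "scaleC a (scaleC b x) = scaleC (a * b) x"
    and scaleC_one: "scaleC 1 x = x"
    and scaleR_scaleC: "scaleR r x = scaleC (complex_of_real r) x"
    and cinner_commute: "cinner x y = cnj (cinner y x)"
    and cinner_add_right: "cinner x (y + z) = cinner x y + cinner x z"
    and cinner_scaleC_right: "cinner x (scaleC a y) = a * cinner x y"
    and norm_eq_sqrt_cinner: "norm x = sqrt (Re (cinner x x))"

definition bounded_clinear_op :: "('a::complex_hilbert \<Rightarrow> 'a) \<Rightarrow> bool" where
  "bounded_clinear_op T \<longleftrightarrow>
     (\<forall>x y. T (x + y) = T x + T y) \<and> (\<forall>c x. T (scaleC c x) = scaleC c (T x)) \<and>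
     (\<exists>K. \<forall>x. norm (T x) \<le> norm x * K)"

definition is_adjoint :: "('a::complex_hilbert \<Rightarrow> 'a) \<Rightarrow> ('a \<Rightarrow> 'a) \<Rightarrow> bool" where
  "is_adjoint T S \<longleftrightarrow> (\<forall>x y. cinner (T x) y = cinner x (S y))"

definition coquasiposinormal :: "('a::complex_hilbert \<Rightarrow> 'a) \<Rightarrow> ('a \<Rightarrow> 'a) \<Rightarrow> bool" where
  "coquasiposinormal T Tadj \<longleftrightarrow> {x. Tadj x = 0} \<subseteq> {x. T x = 0}"

definition paranormal :: "('a::complex_hilbert \<Rightarrow> 'a) \<Rightarrow> bool" where
  "paranormal T \<longleftrightarrow> (\<forall>x. (norm (T x))\<^sup>2 \<le> norm (T (T x)) * norm x)"

definition quasinormal :: "('a::complex_hilbert \<Rightarrow> 'a) \<Rightarrow> ('a \<Rightarrow> 'a) \<Rightarrow> bool" where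
  "quasinormal A Aadj \<longleftrightarrow> (\<forall>x. Aadj (A (A x)) - A (Aadj (A x)) = 0)"

definition normal_op :: "('a::complex_hilbert \<Rightarrow> 'a) \<Rightarrow> ('a \<Rightarrow> 'a) \<Rightarrow> bool" where
  "normal_op T Tadj \<longleftrightarrow> (\<forall>x. T (Tadj x) = Tadj (T x))"

end

(* Write A' for the adjoint of A and N(A) for its kernel. Put Q = T^n and C = Q' Q - Q Q'.
   Quasinormality gives C Q = 0, hence Q' C = 0, so C maps into N(Q') = N(T'), which is contained in
   N(T) and therefore in N(Q); this forces C C = 0 and C = 0. Thus Q is normal.

   The vectors x with |Q^k x| <= const * r^k form a spectral subspace of |Q|. The definition shows that
   it is invariant under T, which commutes with Q, and under T', because |Q^k x| = |Q'^k x|; so T is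
   reduced by it without an appeal to Fuglede's theorem. Paranormality says that k |-> |T^k x| is
   log-convex, so on a band where |Q| lies in [a^n, b^n] the norms |Tx| and |T'x| both lie in
   [a |x|, b |x|]. Cutting the space into ever thinner bands yields |Tx| = |T'x|.

   Complex scalars play no role, so the argument takes place in the underlying real Hilbert space. *)

theory Submission
  imports Defs
begin

subsection \<open>Closed subspaces\<close>

text \<open>Projection theorem: a minimizing sequence for the distance from \<open>x\<close> to
  \<open>M\<close> is Cauchy by the parallelogram law, and its limit is the projection
  \<open>u\<close>.\<close>

lemma orthogonal_decomposition:
  fixes M :: "'a::{real_inner,complete_space} set"
  assumes M: "subspace M" "closed M"
  obtains u where "u \<in> M" "\<And>y. y \<in> M \<Longrightarrow> inner (x - u) y = 0"
proof -
  define d where "d = (INF y\<in>M. (norm (x - y))\<^sup>2)"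
  have bdd: "bdd_below ((\<lambda>y. (norm (x - y))\<^sup>2) ` M)"
    by (rule bdd_belowI[of _ 0]) auto
  have ne: "M \<noteq> {}" using subspace_0[OF M(1)] by auto
  have d_le: "d \<le> (norm (x - y))\<^sup>2" if "y \<in> M" for y
    unfolding d_def using that by (intro cINF_lower bdd)
  have "\<exists>y\<in>M. (norm (x - y))\<^sup>2 < d + 1 / real (Suc k)" for k
    using cINF_less_iff[OF ne bdd, of "d + 1 / real (Suc k)"] by (simp add: d_def)
  then obtain y where yM: "\<And>k. y k \<in> M"
    and y: "\<And>k. (norm (x - y k))\<^sup>2 < d + 1 / real (Suc k)"
    by metis
  have near: "(norm (y j - y k))\<^sup>2 \<le> 2 / real (Suc j) + 2 / real (Suc k)" for j k
  proof -
    \<comment> \<open>The midpoint is at squared distance at least \<open>d\<close> from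
      \<open>x\<close>, so the parallelogram identity forces \<open>y j\<close> and
      \<open>y k\<close> together.\<close>
    have "(1/2) *\<^sub>R (y j + y k) \<in> M"
      by (intro subspace_scale subspace_add M yM)
    then have "d \<le> (norm (x - (1/2) *\<^sub>R (y j + y k)))\<^sup>2" by (rule d_le)
    moreover have "(norm (y j - y k))\<^sup>2 = 2 * (norm (x - y j))\<^sup>2 + 2 * (norm (x - y k))\<^sup>2
        - 4 * (norm (x - (1/2) *\<^sub>R (y j + y k)))\<^sup>2"
      unfolding power2_norm_eq_inner by (simp add: inner_commute algebra_simps)
    ultimately show ?thesis using y[of j] y[of k] by simp
  qed
  have "Cauchy y"
  proof (rule metric_CauchyI)
    fix e :: real assume e: "e > 0"
    obtain N where N: "4 / e\<^sup>2 < real N" using reals_Archimedean2 by blast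
    show "\<exists>N. \<forall>m\<ge>N. \<forall>n\<ge>N. dist (y m) (y n) < e"
    proof (intro exI allI impI)
      fix m n assume mn: "N \<le> m" "N \<le> n"
      have N0: "0 < real N" using N e by (smt (verit) divide_nonneg_pos zero_less_power)
      have "(norm (y m - y n))\<^sup>2 \<le> 2 / real (Suc m) + 2 / real (Suc n)" by (rule near)
      also have "\<dots> \<le> 2 / real N + 2 / real N"
        using mn N0 by (intro add_mono divide_left_mono) auto
      also have "\<dots> < e\<^sup>2" using N N0 e by (simp add: field_simps)
      finally show "dist (y m) (y n) < e"
        using e by (simp add: dist_norm power2_less_imp_less)
    qed
  qed
  then obtain u where u: "y \<longlonglongrightarrow> u" using Cauchy_convergent_iff convergent_def by blast
  have uM: "u \<in> M" using closed_sequentially[OF M(2) _ u] yM by blast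
  have "(norm (x - u))\<^sup>2 \<le> d + 0"
  proof (rule LIMSEQ_le)
    show "(\<lambda>k. (norm (x - y k))\<^sup>2) \<longlonglongrightarrow> (norm (x - u))\<^sup>2" by (intro tendsto_intros u)
    show "(\<lambda>k. d + 1 / real (Suc k)) \<longlonglongrightarrow> d + 0"
      by (intro tendsto_intros) (use LIMSEQ_inverse_real_of_nat in \<open>simp add: inverse_eq_divide\<close>)
  qed (use y less_imp_le in blast)
  then have ud: "(norm (x - u))\<^sup>2 \<le> d" by simp
  show thesis
  proof (rule that[OF uM])
    fix z assume z: "z \<in> M"
    show "inner (x - u) z = 0"
    proof (cases "z = 0")
      case False
      \<comment> \<open>The coefficient minimizing the distance from \<open>x\<close> to
        \<open>u + t *\<^sub>R z\<close>; a nonzero inner product would then beat the infimum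
        \<open>d\<close>.\<close>
      define t where "t = inner (x - u) z / inner z z"
      have "u + t *\<^sub>R z \<in> M" by (intro subspace_add subspace_scale M uM z)
      then have "d \<le> (norm (x - (u + t *\<^sub>R z)))\<^sup>2" by (rule d_le)
      also have "\<dots> = (norm (x - u))\<^sup>2 - 2 * t * inner (x - u) z + t\<^sup>2 * inner z z"
        unfolding power2_norm_eq_inner by (simp add: inner_commute algebra_simps power2_eq_square)
      also have "\<dots> = (norm (x - u))\<^sup>2 - (inner (x - u) z)\<^sup>2 / inner z z"
        using False by (simp add: t_def power2_eq_square)
      finally have "(inner (x - u) z)\<^sup>2 / inner z z \<le> 0" using ud by simp
      moreover have "inner z z > 0" using False by simp
      ultimately show ?thesis by (simp add: divide_le_0_iff)
    qed simp
  qed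
qed

lemma closure_subspace:
  fixes M :: "'a::real_normed_vector set"
  assumes "subspace M"
  shows "subspace (closure M)"
proof (rule subspaceI)
  show "0 \<in> closure M" using closure_subset subspace_0[OF assms] by blast
next
  fix x y assume "x \<in> closure M" "y \<in> closure M"
  then obtain f g where "\<forall>n. f n \<in> M" "f \<longlonglongrightarrow> x" "\<forall>n. g n \<in> M" "g \<longlonglongrightarrow> y"
    unfolding closure_sequential by blast
  then show "x + y \<in> closure M"
    unfolding closure_sequential using assms
    by (intro exI[of _ "\<lambda>n. f n + g n"]) (auto intro: tendsto_add subspace_add)
next
  fix c x assume "x \<in> closure M"
  then obtain f where "\<forall>n. f n \<in> M" "f \<longlonglongrightarrow> x" unfolding closure_sequential by blast
  then show "c *\<^sub>R x \<in> closure M"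
    unfolding closure_sequential using assms
    by (intro exI[of _ "\<lambda>n. c *\<^sub>R f n"]) (auto intro: tendsto_scaleR subspace_scale)
qed

lemma bounded_linear_funpow:
  fixes T :: "'a::real_normed_vector \<Rightarrow> 'a"
  assumes "bounded_linear T"
  shows "bounded_linear (T ^^ k)"
  by (induction k) (auto simp: id_def o_def intro: bounded_linear_compose assms bounded_linear_ident)

subsection \<open>Operators whose orbits have log-convex norms\<close>

text \<open>Paranormality, restated for real normed spaces. Applied to \<open>(T ^^ k) x\<close>, it
  says that the ratios of consecutive orbit norms never decrease.\<close>

definition log_convex_orbits :: "('a::real_normed_vector \<Rightarrow> 'a) \<Rightarrow> bool" where
  "log_convex_orbits T \<longleftrightarrow> (\<forall>x. (norm (T x))\<^sup>2 \<le> norm (T (T x)) * norm x)"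

lemma log_convex_orbits_ratio_step:
  assumes "log_convex_orbits T" "q \<ge> 0" "q * norm x \<le> norm (T x)"
  shows "q * norm (T x) \<le> norm (T (T x))"
proof (cases "T x = 0")
  case False
  have "q * norm (T x) * norm (T x) = q * (norm (T x))\<^sup>2" by (simp add: power2_eq_square)
  also have "\<dots> \<le> q * (norm (T (T x)) * norm x)"
    using assms by (auto simp: log_convex_orbits_def intro: mult_left_mono)
  also have "\<dots> = norm (T (T x)) * (q * norm x)" by simp
  also have "\<dots> \<le> norm (T (T x)) * norm (T x)" using assms(3) by (intro mult_left_mono) auto
  finally show ?thesis using False by simp
qed simp

lemma log_convex_orbits_ratio_mono:
  assumes T: "log_convex_orbits T" "q \<ge> 0"
    and "q * norm ((T ^^ j) x) \<le> norm ((T ^^ Suc j) x)" "j \<le> k"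
  shows "q * norm ((T ^^ k) x) \<le> norm ((T ^^ Suc k) x)"
  using assms(4)
proof (induction k rule: dec_induct)
  case (step k)
  then show ?case using log_convex_orbits_ratio_step[OF T, of "(T ^^ k) x"] by simp
qed (use assms(3) in simp)

lemma log_convex_orbits_geometric:
  assumes T: "log_convex_orbits T" "q \<ge> 0" and "q * norm x \<le> norm (T x)"
  shows "q ^ k * norm x \<le> norm ((T ^^ k) x)"
proof (induction k)
  case (Suc k)
  have "q ^ Suc k * norm x = q * (q ^ k * norm x)" by simp
  also have "\<dots> \<le> q * norm ((T ^^ k) x)" using Suc T by (intro mult_left_mono) auto
  also have "\<dots> \<le> norm ((T ^^ Suc k) x)"
    using log_convex_orbits_ratio_mono[OF T, of 0 x k] assms(3) by simp
  finally show ?case .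
qed simp

lemma log_convex_orbits_zero:
  assumes "log_convex_orbits T" shows "T 0 = 0"
  using assms unfolding log_convex_orbits_def by (metis mult_zero_right norm_zero power2_less_eq_zero_iff norm_eq_zero)

text \<open>If the first ratio \<open>q\<close> exceeded \<open>r\<close>, the orbit would grow at
  least like \<open>q ^ k\<close> and outrun every multiple of \<open>r ^ k\<close>.\<close>

lemma log_convex_orbits_norm_le_rate:
  assumes T: "log_convex_orbits T" and r: "r \<ge> 0"
    and bound: "\<And>k. norm ((T ^^ k) x) \<le> C * r ^ k"
  shows "norm (T x) \<le> r * norm x"
proof (rule ccontr)
  assume "\<not> norm (T x) \<le> r * norm x"
  then have less: "r * norm x < norm (T x)" by simp
  have x: "norm x > 0" using less log_convex_orbits_zero[OF T] by (cases "x = 0") auto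
  define q where "q = norm (T x) / norm x"
  have qr: "q > r" using less x by (simp add: q_def field_simps)
  have le: "q ^ k * norm x \<le> C * r ^ k" for k
    using order_trans[OF log_convex_orbits_geometric[OF T, of q x k] bound[of k]] x by (simp add: q_def)
  show False
  proof (cases "r = 0")
    case True
    \<comment> \<open>For \<open>r = 0\<close> the bound vanishes already at \<open>k = 1\<close>;
      the other case divides by \<open>r\<close>.\<close>
    then show False using le[of 1] qr x by (simp add: mult_le_0_iff)
  next
    case False
    with r have r: "r > 0" by simp
    obtain k where "C / norm x < (q / r) ^ k"
      using real_arch_pow[of "q / r" "C / norm x"] qr r by (auto simp: field_simps)
    then show False using le[of k] x r by (simp add: field_simps power_divide)
  qed
qed

text \<open>The first ratio is the least of the first \<open>n\<close>, so its \<open>n\<close>-th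
  power is at most their product.\<close>

lemma log_convex_orbits_norm_le_root:
  assumes T: "log_convex_orbits T" and c: "c \<ge> 0" "n > 0"
    and bound: "norm ((T ^^ n) x) \<le> c ^ n * norm x"
  shows "norm (T x) \<le> c * norm x"
proof (cases "x = 0")
  case True
  then show ?thesis using log_convex_orbits_zero[OF T] by simp
next
  case False
  define q where "q = norm (T x) / norm x"
  have "q ^ n * norm x \<le> norm ((T ^^ n) x)"
    using log_convex_orbits_geometric[OF T, of q x n] False by (simp add: q_def)
  with bound have "q ^ n * norm x \<le> c ^ n * norm x" by linarith
  then have "q ^ n \<le> c ^ n" using False by simp
  then have "q \<le> c" using c power_mono_iff[of q c n] by (simp add: q_def)
  then show ?thesis using False by (simp add: q_def field_simps)
qed

text \<open>A lower bound on the product of the first \<open>n\<close> ratios does not bound the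
  first ratio from below, only later ones; hence a conclusion at \<open>(T ^^ n) x\<close> instead
  of \<open>x\<close>. Were the ratio there below \<open>a\<close>, all earlier ones would be
  too.\<close>

lemma log_convex_orbits_root_le_norm:
  assumes T: "log_convex_orbits T" and a: "a \<ge> 0" "n > 0"
    and bound: "a ^ n * norm x \<le> norm ((T ^^ n) x)"
  shows "a * norm ((T ^^ n) x) \<le> norm (T ((T ^^ n) x))"
proof (rule ccontr)
  assume "\<not> ?thesis"
  then have less: "norm ((T ^^ Suc j) x) < a * norm ((T ^^ j) x)" if "j \<le> n" for j
    using log_convex_orbits_ratio_mono[OF T a(1), of j x n] that by force
  have "norm ((T ^^ Suc j) x) < a ^ Suc j * norm x" if "j \<le> n" for j
    using that
  proof (induction j)
    case 0
    then show ?case using less[of 0] by simp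
  next
    case (Suc j)
    have "norm ((T ^^ Suc (Suc j)) x) < a * norm ((T ^^ Suc j) x)" by (rule less[OF Suc.prems])
    also have "\<dots> \<le> a * (a ^ Suc j * norm x)" using Suc a by (intro mult_left_mono) auto
    finally show ?case by simp
  qed
  \<comment> \<open>Index \<open>n - 1\<close> speaks about \<open>(T ^^ n) x\<close>, because the
    induction starts at the first power.\<close>
  from this[of "n - 1"] bound a show False by simp
qed

subsection \<open>Square roots of positive operators\<close>

text \<open>
  The iterates \<open>W\<close> of \<open>W \<mapsto> (Z + W\<^sup>2) / 2\<close> converge to \<open>1 - sqrt (1 - Z)\<close>. Consecutive
  differences are dominated by those of the same iteration for the number \<open>1\<close>, so a bounded
  increasing real sequence controls the convergence in norm.
\<close>

primrec sqrt_iter :: "('a::real_vector \<Rightarrow> 'a) \<Rightarrow> nat \<Rightarrow> 'a \<Rightarrow> 'a" where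
  "sqrt_iter Z 0 = (\<lambda>x. 0)"
| "sqrt_iter Z (Suc k) = (\<lambda>x. (1/2) *\<^sub>R (Z x + sqrt_iter Z k (sqrt_iter Z k x)))"

primrec sqrt_iter_bound :: "nat \<Rightarrow> real" where
  "sqrt_iter_bound 0 = 0"
| "sqrt_iter_bound (Suc k) = (1 + (sqrt_iter_bound k)\<^sup>2) / 2"

lemma sqrt_iter_bound_range: "0 \<le> sqrt_iter_bound k \<and> sqrt_iter_bound k \<le> 1"
  by (induction k) (auto simp: abs_square_le_1 power_le_one)

lemma sqrt_iter_bound_mono: "sqrt_iter_bound k \<le> sqrt_iter_bound (Suc k)"
proof -
  have "0 \<le> (1 - sqrt_iter_bound k)\<^sup>2" by simp
  then show ?thesis by (simp add: power2_eq_square algebra_simps)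
qed

lemma linear_sqrt_iter:
  assumes "linear Z" shows "linear (sqrt_iter Z k)"
proof (induction k)
  case 0
  show ?case by (simp add: linear_iff)
next
  case (Suc k)
  show ?case using assms Suc by (simp add: linear_iff algebra_simps)
qed

lemma inner_sqrt_iter:
  assumes "\<And>x y. inner (Z x) y = inner x (Z y)"
  shows "inner (sqrt_iter Z k x) y = inner x (sqrt_iter Z k y)"
  by (induction k arbitrary: x y) (simp_all add: inner_add_left inner_add_right assms)

text \<open>Every iterate is a polynomial in \<open>Z\<close>.\<close>

lemma sqrt_iter_commute:
  assumes "linear B" "\<And>x. B (Z x) = Z (B x)"
  shows "B (sqrt_iter Z k x) = sqrt_iter Z k (B x)"
  by (induction k arbitrary: x) (simp_all add: assms linear_0 linear_add linear_scale)

lemma norm_sqrt_iter_le: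
  assumes "\<And>x. norm (Z x) \<le> norm x"
  shows "norm (sqrt_iter Z k x) \<le> sqrt_iter_bound k * norm x"
proof (induction k arbitrary: x)
  case (Suc k)
  have "norm (sqrt_iter Z k (sqrt_iter Z k x)) \<le> sqrt_iter_bound k * (sqrt_iter_bound k * norm x)"
    using order_trans[OF Suc mult_left_mono[OF Suc]] sqrt_iter_bound_range by blast
  then have "norm (Z x + sqrt_iter Z k (sqrt_iter Z k x))
      \<le> norm x + sqrt_iter_bound k * (sqrt_iter_bound k * norm x)"
    using norm_triangle_le[OF add_mono[OF assms]] by blast
  then have "norm (Z x + sqrt_iter Z k (sqrt_iter Z k x)) / 2
      \<le> (1 + (sqrt_iter_bound k)\<^sup>2) / 2 * norm x"
    by (simp add: power2_eq_square distrib_right)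
  then show ?case by (simp only: sqrt_iter.simps sqrt_iter_bound.simps norm_scaleR)
qed simp

text \<open>Splitting \<open>V V - W W\<close> as \<open>V (V - W) + (V - W) W\<close> gives an
  estimate that the scalar sequence meets with equality, by
  \<open>v v - w w = v (v - w) + (v - w) w\<close>.\<close>

lemma norm_sqrt_iter_diff_Suc_le:
  assumes "linear Z" and Z: "\<And>x. norm (Z x) \<le> norm x"
  shows "norm (sqrt_iter Z (Suc k) x - sqrt_iter Z k x)
      \<le> (sqrt_iter_bound (Suc k) - sqrt_iter_bound k) * norm x"
proof (induction k arbitrary: x)
  case 0
  show ?case using Z[of x] by simp
next
  case (Suc k)
  define w where "w = sqrt_iter_bound k"
  define v where "v = sqrt_iter_bound (Suc k)"
  have wv: "0 \<le> w" "w \<le> v" "0 \<le> v"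
    using sqrt_iter_bound_range sqrt_iter_bound_mono by (auto simp: w_def v_def)
  define W where "W = sqrt_iter Z k"
  define V where "V = sqrt_iter Z (Suc k)"
  have IH: "norm (V y - W y) \<le> (v - w) * norm y" for y
    using Suc by (simp only: v_def w_def V_def W_def)
  have V: "norm (V y) \<le> v * norm y" and W: "norm (W y) \<le> w * norm y" for y
    unfolding V_def v_def W_def w_def by (rule norm_sqrt_iter_le[OF Z])+
  have lin: "linear V" unfolding V_def by (rule linear_sqrt_iter[OF assms(1)])
  have "sqrt_iter Z (Suc (Suc k)) x - sqrt_iter Z (Suc k) x = (1/2) *\<^sub>R (V (V x) - W (W x))"
    by (simp add: V_def W_def scaleR_right_diff_distrib algebra_simps)
  also have "V (V x) - W (W x) = V (V x - W x) + (V (W x) - W (W x))"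
    by (simp add: linear_diff[OF lin])
  finally have eq: "sqrt_iter Z (Suc (Suc k)) x - sqrt_iter Z (Suc k) x
      = (1/2) *\<^sub>R (V (V x - W x) + (V (W x) - W (W x)))" .
  have "norm (V (V x - W x)) \<le> v * ((v - w) * norm x)"
    using order_trans[OF V mult_left_mono[OF IH wv(3)]] .
  moreover have "norm (V (W x) - W (W x)) \<le> (v - w) * (w * norm x)"
    using order_trans[OF IH mult_left_mono[OF W]] wv by simp
  ultimately have "norm (V (V x - W x) + (V (W x) - W (W x)))
      \<le> v * ((v - w) * norm x) + (v - w) * (w * norm x)"
    by (intro norm_triangle_le add_mono)
  then have "norm (sqrt_iter Z (Suc (Suc k)) x - sqrt_iter Z (Suc k) x)
      \<le> (v * ((v - w) * norm x) + (v - w) * (w * norm x)) / 2"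
    unfolding eq by simp
  also have "\<dots> = ((1 + v\<^sup>2) / 2 - (1 + w\<^sup>2) / 2) * norm x"
    by (simp add: power2_eq_square field_simps)
  also have "\<dots> = (sqrt_iter_bound (Suc (Suc k)) - sqrt_iter_bound (Suc k)) * norm x"
    by (simp add: v_def w_def)
  finally show ?case .
qed

lemma norm_sqrt_iter_diff_le:
  assumes Z: "linear Z" "\<And>x. norm (Z x) \<le> norm x" and "j \<le> k"
  shows "norm (sqrt_iter Z k x - sqrt_iter Z j x)
      \<le> (sqrt_iter_bound k - sqrt_iter_bound j) * norm x"
  using assms(3)
proof (induction k rule: dec_induct)
  case (step k)
  have "norm (sqrt_iter Z (Suc k) x - sqrt_iter Z j x)
      \<le> norm (sqrt_iter Z (Suc k) x - sqrt_iter Z k x) + norm (sqrt_iter Z k x - sqrt_iter Z j x)"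
    using norm_triangle_ineq[of "sqrt_iter Z (Suc k) x - sqrt_iter Z k x" "sqrt_iter Z k x - sqrt_iter Z j x"]
    by simp
  also have "\<dots> \<le> (sqrt_iter_bound (Suc k) - sqrt_iter_bound k) * norm x
      + (sqrt_iter_bound k - sqrt_iter_bound j) * norm x"
    by (intro add_mono norm_sqrt_iter_diff_Suc_le Z step.IH)
  finally show ?case by (simp add: left_diff_distrib)
qed simp

text \<open>The limit \<open>W\<close> solves \<open>W = (Z + W W) / 2\<close>, so
  \<open>D = 1 - W\<close> squares to \<open>1 - Z\<close>; it is positive because \<open>W\<close>
  is a contraction.\<close>

lemma sqrt_one_minus_contraction:
  fixes Z :: "'a::{real_inner,complete_space} \<Rightarrow> 'a"
  assumes Z: "linear Z" "\<And>x. norm (Z x) \<le> norm x" "\<And>x y. inner (Z x) y = inner x (Z y)"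
  obtains D where "linear D" "\<And>x y. inner (D x) y = inner x (D y)" "\<And>x. 0 \<le> inner (D x) x"
    "\<And>x. D (D x) = x - Z x"
    "\<forall>B. bounded_linear B \<and> (\<forall>x. B (Z x) = Z (B x)) \<longrightarrow> (\<forall>x. B (D x) = D (B x))"
proof -
  define W where "W x = lim (\<lambda>k. sqrt_iter Z k x)" for x
  have "incseq sqrt_iter_bound" by (rule incseq_SucI) (rule sqrt_iter_bound_mono)
  then have "convergent sqrt_iter_bound"
    using incseq_convergent[of sqrt_iter_bound 1] sqrt_iter_bound_range convergent_def by metis
  then have bC: "Cauchy sqrt_iter_bound" by (rule convergent_Cauchy)
  have "Cauchy (\<lambda>k. sqrt_iter Z k x)" for x
  proof (rule metric_CauchyI)
    fix e :: real assume e: "e > 0"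
    \<comment> \<open>Adding 1 keeps the divisor positive at \<open>x = 0\<close>.\<close>
    have e': "e / (norm x + 1) > 0" using e by (simp add: add_nonneg_pos)
    obtain N where N: "\<And>m n. m \<ge> N \<Longrightarrow> n \<ge> N \<Longrightarrow>
        dist (sqrt_iter_bound m) (sqrt_iter_bound n) < e / (norm x + 1)"
      using metric_CauchyD[OF bC e'] by blast
    have le: "dist (sqrt_iter Z m x) (sqrt_iter Z n x) < e" if "N \<le> n" "n \<le> m" for m n
    proof -
      have "dist (sqrt_iter Z m x) (sqrt_iter Z n x)
          \<le> (sqrt_iter_bound m - sqrt_iter_bound n) * norm x"
        unfolding dist_norm using norm_sqrt_iter_diff_le[OF Z(1,2) that(2)] .
      also have "\<dots> \<le> e / (norm x + 1) * norm x"
        using N[of m n] that by (intro mult_right_mono) (auto simp: dist_real_def)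
      also have "\<dots> < e" using e by (simp add: pos_divide_less_eq add_nonneg_pos)
      finally show ?thesis .
    qed
    then show "\<exists>N. \<forall>m\<ge>N. \<forall>n\<ge>N. dist (sqrt_iter Z m x) (sqrt_iter Z n x) < e"
      by (metis dist_commute nle_le)
  qed
  then have lim: "(\<lambda>k. sqrt_iter Z k x) \<longlonglongrightarrow> W x" for x
    unfolding W_def using Cauchy_convergent_iff convergent_LIMSEQ_iff by blast
  have linW: "linear W"
  proof (rule linearI)
    fix x y
    have "(\<lambda>k. sqrt_iter Z k (x + y)) \<longlonglongrightarrow> W x + W y"
      using tendsto_add[OF lim lim] by (simp add: linear_add[OF linear_sqrt_iter[OF Z(1)]])
    then show "W (x + y) = W x + W y" using lim LIMSEQ_unique by blast
  next
    fix c x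
    have "(\<lambda>k. sqrt_iter Z k (c *\<^sub>R x)) \<longlonglongrightarrow> c *\<^sub>R W x"
      using tendsto_scaleR[OF tendsto_const lim] by (simp add: linear_scale[OF linear_sqrt_iter[OF Z(1)]])
    then show "W (c *\<^sub>R x) = c *\<^sub>R W x" using lim LIMSEQ_unique by blast
  qed
  have contr: "norm (sqrt_iter Z k x) \<le> norm x" for k x
    using order_trans[OF norm_sqrt_iter_le[OF Z(2)]] sqrt_iter_bound_range mult_left_le_one_le
    by (metis norm_ge_zero)
  have normW: "norm (W x) \<le> norm x" for x
    by (rule LIMSEQ_le_const2[OF tendsto_norm[OF lim]]) (use contr in blast)
  have symW: "inner (W x) y = inner x (W y)" for x y
  proof (rule LIMSEQ_unique)
    show "(\<lambda>k. inner (sqrt_iter Z k x) y) \<longlonglongrightarrow> inner (W x) y" by (intro tendsto_intros lim)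
    show "(\<lambda>k. inner (sqrt_iter Z k x) y) \<longlonglongrightarrow> inner x (W y)"
      unfolding inner_sqrt_iter[OF Z(3)] by (intro tendsto_intros lim)
  qed
  have fixW: "W x = (1/2) *\<^sub>R (Z x + W (W x))" for x
  proof (rule LIMSEQ_unique[OF LIMSEQ_Suc[OF lim]])
    \<comment> \<open>Operator and argument both vary with \<open>k\<close>; since all iterates are
      contractions, the moving argument may be replaced by its limit.\<close>
    have "(\<lambda>k. sqrt_iter Z k (sqrt_iter Z k x - W x)) \<longlonglongrightarrow> 0"
    proof (rule Lim_null_comparison)
      show "(\<lambda>k. norm (sqrt_iter Z k x - W x)) \<longlonglongrightarrow> 0"
        using tendsto_diff[OF lim[of x] tendsto_const[of "W x"]] by (simp add: tendsto_norm_zero)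
    qed (use contr in auto)
    then have "(\<lambda>k. sqrt_iter Z k (sqrt_iter Z k x - W x) + sqrt_iter Z k (W x)) \<longlonglongrightarrow> 0 + W (W x)"
      by (intro tendsto_add lim)
    then have "(\<lambda>k. sqrt_iter Z k (sqrt_iter Z k x)) \<longlonglongrightarrow> W (W x)"
      by (simp add: linear_diff[OF linear_sqrt_iter[OF Z(1)]])
    then show "(\<lambda>k. sqrt_iter Z (Suc k) x) \<longlonglongrightarrow> (1/2) *\<^sub>R (Z x + W (W x))"
      by (auto intro!: tendsto_intros)
  qed
  have comm: "B (W x) = W (B x)" if B: "bounded_linear B" "\<And>x. B (Z x) = Z (B x)" for B x
  proof (rule LIMSEQ_unique)
    show "(\<lambda>k. B (sqrt_iter Z k x)) \<longlonglongrightarrow> B (W x)"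
      by (rule bounded_linear.tendsto[OF B(1) lim])
    show "(\<lambda>k. B (sqrt_iter Z k x)) \<longlonglongrightarrow> W (B x)"
      using lim[of "B x"] sqrt_iter_commute[of B Z, OF bounded_linear.linear[OF B(1)] B(2)] by simp
  qed
  show thesis
  proof (rule that[of "\<lambda>x. x - W x"])
    show "linear (\<lambda>x. x - W x)" using linear_compose_sub[OF linear_id linW] by (simp add: id_def)
    show "inner (x - W x) y = inner x (y - W y)" for x y
      by (simp add: inner_diff_left inner_diff_right symW)
    show "0 \<le> inner (x - W x) x" for x
    proof -
      have "inner (W x) x \<le> norm (W x) * norm x" by (rule norm_cauchy_schwarz)
      also have "\<dots> \<le> norm x * norm x" by (intro mult_right_mono normW) simp
      finally show ?thesis by (simp add: inner_diff_left norm_eq_sqrt_inner)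
    qed
    show "(x - W x) - W (x - W x) = x - Z x" for x
    proof -
      have "W x + W x = Z x + W (W x)"
        by (subst (1 2) fixW) (simp flip: scaleR_left_distrib)
      then show ?thesis by (simp add: linear_diff[OF linW] algebra_simps)
    qed
    have "B (x - W x) = B x - W (B x)" if "bounded_linear B" "\<And>x. B (Z x) = Z (B x)" for B x
      using comm[OF that] linear_diff[OF bounded_linear.linear[OF that(1)]] by simp
    then show "\<forall>B. bounded_linear B \<and> (\<forall>x. B (Z x) = Z (B x)) \<longrightarrow>
        (\<forall>x. B (x - W x) = B x - W (B x))"
      by blast
  qed
qed

subsection \<open>Adjoints and normal operators\<close>

definition adjoint_pair :: "('a::real_inner \<Rightarrow> 'a) \<Rightarrow> ('a \<Rightarrow> 'a) \<Rightarrow> bool" where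
  "adjoint_pair T S \<longleftrightarrow>
     bounded_linear T \<and> bounded_linear S \<and> (\<forall>x y. inner (T x) y = inner x (S y))"

lemma adjoint_pairD:
  assumes "adjoint_pair T S"
  shows "bounded_linear T" "bounded_linear S" "linear T" "linear S"
    and "inner (T x) y = inner x (S y)" "inner (S x) y = inner x (T y)"
  using assms bounded_linear.linear unfolding adjoint_pair_def by (auto simp: inner_commute)

text \<open>Linearity of \<open>S\<close> comes from nondegeneracy of the inner product, boundedness
  from \<open>|S x|^2 = <T (S x), x>\<close> and Cauchy-Schwarz.\<close>

lemma adjoint_pairI:
  assumes T: "bounded_linear T" and adj: "\<And>x y. inner (T x) y = inner x (S y)"
  shows "adjoint_pair T S"
proof -
  obtain K where K: "K \<ge> 0" "\<And>x. norm (T x) \<le> norm x * K"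
    using bounded_linear.nonneg_bounded[OF T] by blast
  have eqI: "x = y" if "\<And>z. inner z x = inner z y" for x y :: 'a
  proof -
    have "inner (x - y) (x - y) = 0"
      unfolding inner_diff_right[of "x - y"] using that by simp
    then show ?thesis by simp
  qed
  have "bounded_linear S"
  proof (rule bounded_linear_intro[of _ K])
    show "S (x + y) = S x + S y" for x y by (rule eqI) (simp add: inner_add_right flip: adj)
    show "S (r *\<^sub>R x) = r *\<^sub>R S x" for r x by (rule eqI) (simp flip: adj)
    show "norm (S x) \<le> norm x * K" for x
    proof -
      have "norm (S x) * norm (S x) = inner (T (S x)) x"
        by (simp add: adj flip: power2_norm_eq_inner power2_eq_square)
      also have "\<dots> \<le> norm (T (S x)) * norm x" by (rule norm_cauchy_schwarz)
      also have "\<dots> \<le> (norm (S x) * K) * norm x" by (intro mult_right_mono K) simp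
      finally have "norm (S x) * norm (S x) \<le> norm (S x) * (norm x * K)" by (simp add: mult_ac)
      then show ?thesis using K(1) by (cases "S x = 0") auto
    qed
  qed
  then show ?thesis using T adj by (simp add: adjoint_pair_def)
qed

lemma adjoint_pair_funpow:
  assumes "adjoint_pair T S" shows "adjoint_pair (T ^^ k) (S ^^ k)"
proof -
  have "inner ((T ^^ k) x) y = inner x ((S ^^ k) y)" for x y
    by (induction k arbitrary: x y) (simp_all add: adjoint_pairD(5)[OF assms] funpow_swap1)
  then show ?thesis
    using adjoint_pairD[OF assms] by (auto simp: adjoint_pair_def bounded_linear_funpow)
qed

lemma adjoint_commute:
  assumes "adjoint_pair A A'" "adjoint_pair B B'" "\<And>x. A (B x) = B (A x)"
  shows "A' (B' x) = B' (A' x)"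
proof -
  have "inner y (A' (B' x) - B' (A' x)) = 0" for y
    using assms(3)[of y]
    by (simp add: inner_diff_right adjoint_pairD(5)[OF assms(1), symmetric] adjoint_pairD(5)[OF assms(2), symmetric])
  then have "A' (B' x) - B' (A' x) = 0" using inner_eq_zero_iff by blast
  then show ?thesis by simp
qed

lemma norm_adjoint_eq:
  assumes "adjoint_pair Q R" "\<And>x. Q (R x) = R (Q x)"
  shows "norm (R x) = norm (Q x)"
  unfolding norm_eq_sqrt_inner using assms by (simp add: adjoint_pairD(5,6)[OF assms(1)])

lemma norm_funpow_adjoint_eq:
  assumes "adjoint_pair Q R" "\<And>x. Q (R x) = R (Q x)"
  shows "norm ((R ^^ k) x) = norm ((Q ^^ k) x)"
proof (induction k arbitrary: x)
  case (Suc k)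
  have "norm ((R ^^ Suc k) x) = norm ((R ^^ k) (R x))" by (simp add: funpow_swap1)
  also have "\<dots> = norm ((Q ^^ k) (R x))" by (rule Suc)
  also have "(Q ^^ k) (R x) = R ((Q ^^ k) x)"
    by (induction k) (simp_all add: assms(2))
  also have "norm \<dots> = norm (Q ((Q ^^ k) x))" by (rule norm_adjoint_eq[OF assms])
  finally show ?case by simp
qed simp

text \<open>Makes the orbit estimates available for the normal operator \<open>Q\<close> itself, and
  thereby turns growth bounds into one-step bounds.\<close>

lemma normal_log_convex_orbits:
  assumes "adjoint_pair Q R" "\<And>x. Q (R x) = R (Q x)"
  shows "log_convex_orbits Q"
  unfolding log_convex_orbits_def
proof
  fix x
  have "(norm (Q x))\<^sup>2 = inner (R (Q x)) x"
    unfolding power2_norm_eq_inner by (simp add: adjoint_pairD(6)[OF assms(1)])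
  also have "\<dots> \<le> norm (R (Q x)) * norm x" by (rule norm_cauchy_schwarz)
  finally show "(norm (Q x))\<^sup>2 \<le> norm (Q (Q x)) * norm x" by (simp add: norm_adjoint_eq[OF assms])
qed

subsection \<open>Spectral subspaces by growth rate\<close>

text \<open>
  For a normal operator this is the spectral subspace of the disc of radius \<open>r\<close>.
\<close>

definition growth_space :: "('a::real_normed_vector \<Rightarrow> 'a) \<Rightarrow> real \<Rightarrow> 'a set" where
  "growth_space Q r = {x. \<exists>C. \<forall>k. norm ((Q ^^ k) x) \<le> C * r ^ k}"

lemma growth_spaceI: "(\<And>k. norm ((Q ^^ k) x) \<le> C * r ^ k) \<Longrightarrow> x \<in> growth_space Q r"
  unfolding growth_space_def by blast

lemma growth_spaceE:
  assumes "x \<in> growth_space Q r" "r \<ge> 0"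
  obtains C where "C \<ge> 0" "\<And>k. norm ((Q ^^ k) x) \<le> C * r ^ k"
proof -
  obtain C where C: "\<And>k. norm ((Q ^^ k) x) \<le> C * r ^ k"
    using assms unfolding growth_space_def by blast
  have "C \<ge> 0" using order_trans[OF norm_ge_zero C[of 0]] by simp
  then show thesis using that C by blast
qed

lemma subspace_growth_space:
  assumes "linear Q" "r \<ge> 0"
  shows "subspace (growth_space Q r)"
proof -
  have lin: "linear (Q ^^ k)" for k
    by (induction k) (auto simp: id_def o_def intro: linear_compose[unfolded o_def] assms linear_ident)
  show ?thesis
  proof (rule subspaceI)
    show "0 \<in> growth_space Q r" by (rule growth_spaceI[of _ _ 0]) (simp add: linear_0[OF lin])
  next
    fix x y assume "x \<in> growth_space Q r" "y \<in> growth_space Q r"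
    then obtain C D where "\<And>k. norm ((Q ^^ k) x) \<le> C * r ^ k" "\<And>k. norm ((Q ^^ k) y) \<le> D * r ^ k"
      using growth_spaceE assms(2) by metis
    then show "x + y \<in> growth_space Q r"
      by (intro growth_spaceI[of _ _ "C + D"])
        (simp add: linear_add[OF lin] distrib_right norm_triangle_mono)
  next
    fix c x assume "x \<in> growth_space Q r"
    then obtain C where C: "\<And>k. norm ((Q ^^ k) x) \<le> C * r ^ k"
      using growth_spaceE assms(2) by metis
    have "norm ((Q ^^ k) (c *\<^sub>R x)) \<le> \<bar>c\<bar> * C * r ^ k" for k
      using mult_left_mono[OF C[of k], of "\<bar>c\<bar>"] by (simp add: linear_scale[OF lin] mult.assoc)
    then show "c *\<^sub>R x \<in> growth_space Q r" by (rule growth_spaceI)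
  qed
qed

lemma growth_space_commute:
  assumes "r \<ge> 0" "bounded_linear B" "\<And>x. B (Q x) = Q (B x)" "x \<in> growth_space Q r"
  shows "B x \<in> growth_space Q r"
proof -
  obtain C where C: "\<And>k. norm ((Q ^^ k) x) \<le> C * r ^ k"
    using growth_spaceE[OF assms(4,1)] by blast
  obtain K where K: "K \<ge> 0" "\<And>x. norm (B x) \<le> norm x * K"
    using bounded_linear.nonneg_bounded[OF assms(2)] by blast
  have comm: "(Q ^^ k) (B x) = B ((Q ^^ k) x)" for k by (induction k) (simp_all add: assms(3))
  have "norm ((Q ^^ k) (B x)) \<le> (C * K) * r ^ k" for k
    using order_trans[OF K(2)[of "(Q ^^ k) x"] mult_right_mono[OF C[of k] K(1)]]
    by (simp add: comm mult_ac)
  then show ?thesis by (rule growth_spaceI)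
qed

text \<open>Log-convexity trades the unspecified constant \<open>C\<close> for 1.\<close>

lemma growth_space_norm_le:
  assumes "log_convex_orbits Q" "r \<ge> 0" "x \<in> growth_space Q r"
  shows "norm (Q x) \<le> r * norm x"
  using growth_spaceE[OF assms(3,2)] log_convex_orbits_norm_le_rate[OF assms(1,2)] by metis

text \<open>The existential over \<open>C\<close> hides closedness. It is equivalent to one-step
  bounds along the whole orbit, each of which is a closed condition.\<close>

lemma closed_growth_space:
  assumes "bounded_linear Q" "log_convex_orbits Q" "r \<ge> 0"
  shows "closed (growth_space Q r)"
proof -
  have eq: "growth_space Q r = {x. \<forall>k. norm ((Q ^^ Suc k) x) \<le> r * norm ((Q ^^ k) x)}"
  proof (intro set_eqI iffI CollectI allI)
    fix x k assume x: "x \<in> growth_space Q r"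
    have "(Q ^^ k) x \<in> growth_space Q r"
    proof (induction k)
      case (Suc k)
      then show ?case using growth_space_commute[OF assms(3,1)] by simp
    qed (use x in simp)
    then show "norm ((Q ^^ Suc k) x) \<le> r * norm ((Q ^^ k) x)"
      using growth_space_norm_le[OF assms(2,3)] by simp
  next
    fix x assume "x \<in> {x. \<forall>k. norm ((Q ^^ Suc k) x) \<le> r * norm ((Q ^^ k) x)}"
    then have le: "norm ((Q ^^ Suc k) x) \<le> r * norm ((Q ^^ k) x)" for k by blast
    have "norm ((Q ^^ k) x) \<le> norm x * r ^ k" for k
    proof (induction k)
      case (Suc k)
      then show ?case using order_trans[OF le[of k] mult_left_mono[OF Suc assms(3)]]
        by (simp add: mult_ac)
    qed simp
    then show "x \<in> growth_space Q r" by (rule growth_spaceI)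
  qed
  have cont: "continuous_on UNIV (Q ^^ k)" for k
    by (rule linear_continuous_on[OF bounded_linear_funpow[OF assms(1)]])
  have "closed {x. norm ((Q ^^ Suc k) x) \<le> r * norm ((Q ^^ k) x)}" for k
    by (intro closed_Collect_le continuous_intros cont)
  then have "closed (\<Inter>k. {x. norm ((Q ^^ Suc k) x) \<le> r * norm ((Q ^^ k) x)})"
    by (intro closed_INT ballI)
  moreover have "growth_space Q r = (\<Inter>k. {x. norm ((Q ^^ Suc k) x) \<le> r * norm ((Q ^^ k) x)})"
    unfolding eq by blast
  ultimately show ?thesis by simp
qed

text \<open>Taking adjoints shows only that \<open>S\<close> commutes with \<open>R\<close>, but by
  normality \<open>Q\<close> and \<open>R\<close> have the same growth spaces.\<close>

lemma growth_space_commute_adjoint: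
  assumes Q: "adjoint_pair Q R" "\<And>x. Q (R x) = R (Q x)" and T: "adjoint_pair T S"
    and comm: "\<And>x. T (Q x) = Q (T x)" and r: "r \<ge> 0" "x \<in> growth_space Q r"
  shows "T x \<in> growth_space Q r" "S x \<in> growth_space Q r"
proof -
  show "T x \<in> growth_space Q r"
    using growth_space_commute[of r T Q x] r comm adjoint_pairD(1)[OF T] by blast
  have eq: "growth_space R r = growth_space Q r"
    unfolding growth_space_def by (simp add: norm_funpow_adjoint_eq[OF Q])
  show "S x \<in> growth_space Q r"
    using growth_space_commute[of r S R x] adjoint_commute[OF T Q(1) comm] adjoint_pairD(2)[OF T] r eq
    by blast
qed

text \<open>
  With \<open>B\<close> a multiple of \<open>R Q - r\<^sup>2\<close> and \<open>D = |B|\<close>, the range of \<open>D - B\<close> lies in the kernel of \<open>D + B\<close>,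
  on which \<open>R Q \<le> r\<^sup>2\<close>. Hence \<open>D = B\<close> on the orthogonal complement of the growth space.
\<close>

lemma growth_space_complement_norm_ge:
  fixes Q R :: "'a::{real_inner,complete_space} \<Rightarrow> 'a"
  assumes Q: "adjoint_pair Q R" "\<And>x. Q (R x) = R (Q x)" and r: "r \<ge> 0"
    and perp: "\<And>y. y \<in> growth_space Q r \<Longrightarrow> inner x y = 0"
  shows "r * norm x \<le> norm (Q x)"
proof -
  note lin = linear_add[OF adjoint_pairD(3)[OF Q(1)]] linear_diff[OF adjoint_pairD(3)[OF Q(1)]]
    linear_scale[OF adjoint_pairD(3)[OF Q(1)]]
    linear_add[OF adjoint_pairD(4)[OF Q(1)]] linear_diff[OF adjoint_pairD(4)[OF Q(1)]]
    linear_scale[OF adjoint_pairD(4)[OF Q(1)]]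
  have blQ: "bounded_linear (\<lambda>x. R (Q x))"
    by (rule bounded_linear_compose) (use adjoint_pairD(1,2)[OF Q(1)] in auto)
  define A where "A x = R (Q x) - r\<^sup>2 *\<^sub>R x" for x
  have A: "bounded_linear A" unfolding A_def
    by (intro bounded_linear_sub bounded_linear_const_scaleR bounded_linear_ident blQ)
  have symA: "inner (A x) y = inner x (A y)" for x y
    by (simp add: A_def inner_diff_left inner_diff_right adjoint_pairD(5,6)[OF Q(1)])
  \<comment> \<open>Division by \<open>s\<close> turns \<open>A\<close> into a contraction without
    changing the sign of its quadratic form.\<close>
  obtain s where s: "s > 0" "\<And>x. norm (A x) \<le> norm x * s"
    using bounded_linear.pos_bounded[OF A] by blast
  define B where "B x = (1/s) *\<^sub>R A x" for x
  have B: "bounded_linear B" unfolding B_def by (intro bounded_linear_const_scaleR A)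
  have linB: "linear B" using B bounded_linear.linear by blast
  have symB: "inner (B x) y = inner x (B y)" for x y by (simp add: B_def symA)
  have normB: "norm (B x) \<le> norm x" for x
    using s(2)[of x] s(1) by (simp add: B_def field_simps)
  \<comment> \<open>With \<open>Z = 1 - B B\<close>, the positive root \<open>D\<close> of
    \<open>1 - Z\<close> is the absolute value of \<open>B\<close>.\<close>
  define Z where "Z x = x - B (B x)" for x
  have linZ: "linear Z"
    unfolding linear_iff Z_def by (simp add: linear_add[OF linB] linear_scale[OF linB] algebra_simps)
  have symZ: "inner (Z x) y = inner x (Z y)" for x y
    by (simp add: Z_def inner_diff_left inner_diff_right symB)
  have normZ: "norm (Z x) \<le> norm x" for x
  proof -
    have "(norm (Z x))\<^sup>2 = (norm x)\<^sup>2 - 2 * (norm (B x))\<^sup>2 + (norm (B (B x)))\<^sup>2"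
      unfolding Z_def power2_norm_eq_inner
      by (simp add: inner_diff_left inner_diff_right symB[of "B x" x] symB[of x "B x", symmetric])
    also have "\<dots> \<le> (norm x)\<^sup>2"
      using power_mono[OF normB[of "B x"] norm_ge_zero, of 2] zero_le_power2[of "norm (B x)"] by linarith
    finally show ?thesis by (rule power2_le_imp_le) simp
  qed
  obtain D where D: "linear D" "\<And>x y. inner (D x) y = inner x (D y)" "\<And>x. 0 \<le> inner (D x) x"
    "\<And>x. D (D x) = x - Z x"
    "\<forall>B. bounded_linear B \<and> (\<forall>x. B (Z x) = Z (B x)) \<longrightarrow> (\<forall>x. B (D x) = D (B x))"
    using sqrt_one_minus_contraction[OF linZ normZ symZ] by blast
  have DD: "D (D x) = B (B x)" for x by (simp add: D(4) Z_def)
  have BD: "B (D x) = D (B x)" for x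
    using D(5)[rule_format, of B] B by (simp add: Z_def linear_diff[OF linB])
  have QB: "Q (B x) = B (Q x)" for x
    by (simp add: B_def A_def lin Q(2))
  have QD: "Q (D x) = D (Q x)" for x
    using D(5)[rule_format, of Q] adjoint_pairD(1)[OF Q(1)] by (simp add: Z_def lin QB)
  \<comment> \<open>\<open>Q\<close> commutes with \<open>D\<close> and \<open>B\<close>, so the
    orbit of \<open>v\<close> stays in the kernel of \<open>D + B\<close>. There
    \<open><B y, y> = - <D y, y>\<close> is nonpositive, so each step grows by at most the factor
    \<open>r\<close>.\<close>
  have kernel: "v \<in> growth_space Q r" if v: "D v + B v = 0" for v
  proof -
    have pow: "D ((Q ^^ k) v) + B ((Q ^^ k) v) = 0" for k
    proof (induction k)
      case (Suc k)
      have "Q (D ((Q ^^ k) v) + B ((Q ^^ k) v)) = 0"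
        using Suc linear_0[OF adjoint_pairD(3)[OF Q(1)]] by simp
      then show ?case by (simp add: lin QD QB)
    qed (use v in simp)
    have le: "norm (Q y) \<le> r * norm y" if "D y + B y = 0" for y
    proof -
      have "B y = - D y" using that by (simp add: eq_neg_iff_add_eq_0 add.commute)
      then have "inner (B y) y \<le> 0" using D(3)[of y] by simp
      then have "inner (A y) y \<le> 0" using s(1) by (simp add: B_def divide_le_0_iff)
      then have "(norm (Q y))\<^sup>2 \<le> (r * norm y)\<^sup>2"
        unfolding power_mult_distrib power2_norm_eq_inner
        by (simp add: A_def inner_diff_left adjoint_pairD(6)[OF Q(1)])
      then show ?thesis by (rule power2_le_imp_le) (use r in simp)
    qed
    have "norm ((Q ^^ k) v) \<le> norm v * r ^ k" for k
    proof (induction k)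
      case (Suc k)
      show ?case using order_trans[OF le[OF pow[of k]] mult_left_mono[OF Suc r]]
        by (simp add: mult_ac)
    qed simp
    then show ?thesis by (rule growth_spaceI)
  qed
  have "inner (D x - B x) y = 0" for y
  proof -
    \<comment> \<open>Since \<open>D\<close> and \<open>B\<close> commute,
      \<open>(D + B) (D - B) = D D - B B = 0\<close>.\<close>
    have "D (D y - B y) + B (D y - B y) = 0"
      by (simp add: linear_diff[OF D(1)] linear_diff[OF linB] DD BD)
    then have "inner x (D y - B y) = 0" using perp kernel by blast
    then show ?thesis by (simp add: inner_diff_left inner_diff_right D(2) symB)
  qed
  then have "D x - B x = 0" using inner_eq_zero_iff by blast
  then have "0 \<le> inner (B x) x" using D(3)[of x] by simp
  then have "0 \<le> inner (A x) x" using s(1) by (simp add: B_def zero_le_divide_iff)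
  then have "(r * norm x)\<^sup>2 \<le> (norm (Q x))\<^sup>2"
    unfolding power_mult_distrib power2_norm_eq_inner
    by (simp add: A_def inner_diff_left adjoint_pairD(6)[OF Q(1)])
  then show ?thesis by (rule power2_le_imp_le) simp
qed

subsection \<open>Paranormal roots of normal operators\<close>

lemma funpow_invariant:
  assumes "\<And>x. x \<in> V \<Longrightarrow> T x \<in> V" "x \<in> V" shows "(T ^^ k) x \<in> V"
  by (induction k) (use assms in auto)

text \<open>The bound for \<open>S\<close> follows from \<open>|S x|^2 = <T (S x), x>\<close> and
  the bound for \<open>T\<close> at \<open>S x\<close>, which invariance keeps in
  \<open>V\<close>.\<close>

lemma root_norm_le:
  assumes T: "adjoint_pair T S" "log_convex_orbits T" and n: "n > 0" "c \<ge> 0"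
    and inv: "\<And>x. x \<in> V \<Longrightarrow> S x \<in> V"
    and bound: "\<And>x. x \<in> V \<Longrightarrow> norm ((T ^^ n) x) \<le> c ^ n * norm x" and x: "x \<in> V"
  shows "norm (T x) \<le> c * norm x" "norm (S x) \<le> c * norm x"
proof -
  have le: "norm (T y) \<le> c * norm y" if "y \<in> V" for y
    by (rule log_convex_orbits_norm_le_root[OF T(2) n(2,1) bound[OF that]])
  show "norm (T x) \<le> c * norm x" using le x .
  have "norm (S x) * norm (S x) = inner (T (S x)) x"
    by (simp add: adjoint_pairD(5)[OF T(1)] flip: power2_norm_eq_inner power2_eq_square)
  also have "\<dots> \<le> norm (T (S x)) * norm x" by (rule norm_cauchy_schwarz)
  also have "\<dots> \<le> (c * norm (S x)) * norm x" by (intro mult_right_mono le inv x) simp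
  finally have "norm (S x) * norm (S x) \<le> norm (S x) * (c * norm x)" by (simp add: mult_ac)
  then show "norm (S x) \<le> c * norm x" using n(2) by (cases "S x = 0") auto
qed

text \<open>Log-convexity gives lower bounds only at vectors \<open>(T ^^ n) y\<close>. These are
  dense in \<open>V\<close>, so the bounds extend by continuity.\<close>

lemma root_norm_ge:
  fixes T S :: "'a::{real_inner,complete_space} \<Rightarrow> 'a"
  assumes T: "adjoint_pair T S" "log_convex_orbits T" and n: "n > 0" "a \<ge> 0"
    and normal: "\<And>x. (T ^^ n) ((S ^^ n) x) = (S ^^ n) ((T ^^ n) x)"
    and V: "subspace V" "closed V" "\<And>x. x \<in> V \<Longrightarrow> T x \<in> V" "\<And>x. x \<in> V \<Longrightarrow> S x \<in> V"
    and bound: "\<And>x. x \<in> V \<Longrightarrow> a ^ n * norm x \<le> norm ((T ^^ n) x)" and x: "x \<in> V"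
  shows "a * norm x \<le> norm (T x)" "a * norm x \<le> norm (S x)"
proof -
  define Q where "Q = T ^^ n"
  define R where "R = S ^^ n"
  have Q: "adjoint_pair Q R" unfolding Q_def R_def by (rule adjoint_pair_funpow[OF T(1)])
  have QR: "Q (R y) = R (Q y)" for y using normal by (simp add: Q_def R_def)
  have QV: "Q y \<in> V" and RV: "R y \<in> V" if "y \<in> V" for y
    unfolding Q_def R_def using funpow_invariant[OF V(3) that] funpow_invariant[OF V(4) that] by auto
  have "a * norm x \<le> norm (T x) \<and> a * norm x \<le> norm (S x)"
  proof (cases "a = 0")
    case False
    with n have a: "a > 0" by simp
    have sub: "subspace (closure (Q ` V))"
      by (intro closure_subspace linear_subspace_image adjoint_pairD(3)[OF Q] V(1))
    have clV: "closure (Q ` V) \<subseteq> V" using QV V(2) by (intro closure_minimal) auto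
    \<comment> \<open>Density: if \<open>v = z - u\<close> is orthogonal to the range, then
      \<open>Q (R v)\<close> in the range gives \<open>R v = 0\<close>, normality gives
      \<open>Q v = 0\<close>, and \<open>bound\<close> with \<open>a > 0\<close> gives
      \<open>v = 0\<close>.\<close>
    have VV: "z \<in> closure (Q ` V)" if z: "z \<in> V" for z
    proof -
      obtain u where u: "u \<in> closure (Q ` V)" "\<And>y. y \<in> closure (Q ` V) \<Longrightarrow> inner (z - u) y = 0"
        using orthogonal_decomposition[OF sub closed_closure, of z] by blast
      have v: "z - u \<in> V" by (rule subspace_diff[OF V(1) z subsetD[OF clV u(1)]])
      have "Q (R (z - u)) \<in> closure (Q ` V)" by (intro subsetD[OF closure_subset] imageI RV v)
      then have "inner (z - u) (Q (R (z - u))) = 0" by (rule u(2))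
      then have "inner (R (z - u)) (R (z - u)) = 0"
        unfolding adjoint_pairD(6)[OF Q, of "z - u"] .
      then have "R (z - u) = 0" by simp
      then have "norm (Q (z - u)) = 0" using norm_adjoint_eq[OF Q QR, of "z - u"] by simp
      then have "a ^ n * norm (z - u) \<le> 0" using bound[OF v] by (simp add: Q_def)
      then have "z - u = 0" using zero_less_power[OF a, of n] by (auto simp: mult_le_0_iff)
      then show ?thesis using u(1) by simp
    qed
    have geT: "a * norm (Q y) \<le> norm (T (Q y))" if "y \<in> V" for y
      unfolding Q_def by (rule log_convex_orbits_root_le_norm[OF T(2) n(2,1) bound[OF that]])
    have cont: "continuous_on UNIV T" "continuous_on UNIV S"
      using adjoint_pairD(1,2)[OF T(1)] by (auto intro: linear_continuous_on)
    have "closure (Q ` V) \<subseteq> {z. a * norm z \<le> norm (T z)}"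
      using geT by (intro closure_minimal closed_Collect_le continuous_intros cont) auto
    then have geT': "a * norm z \<le> norm (T z)" if "z \<in> V" for z using VV[OF that] by blast
    have geS: "a * norm (Q y) \<le> norm (S (Q y))" if "y \<in> V" for y
    proof -
      \<comment> \<open>Writing \<open>Q y = T w\<close> allows
        \<open>|T w|^2 = <w, S (T w)> \<le> |w| |S (T w)|\<close>, where
        \<open>a |w| \<le> |T w|\<close> is already known.\<close>
      define w where "w = (T ^^ (n - 1)) y"
      have w: "w \<in> V" unfolding w_def by (rule funpow_invariant[OF V(3) that])
      have Qw: "Q y = T w" using n(1) by (cases n) (simp_all add: Q_def w_def)
      have "norm (T w) * norm (T w) = inner w (S (T w))"
        by (simp add: adjoint_pairD(5)[OF T(1), symmetric] flip: power2_norm_eq_inner power2_eq_square)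
      also have "\<dots> \<le> norm w * norm (S (T w))" by (rule norm_cauchy_schwarz)
      finally have "a * (norm (T w) * norm (T w)) \<le> (a * norm w) * norm (S (T w))"
        using a by (simp add: mult.assoc)
      also have "\<dots> \<le> norm (T w) * norm (S (T w))"
        using geT'[OF w] by (intro mult_right_mono) auto
      finally show ?thesis unfolding Qw by (cases "T w = 0") (auto simp: mult_ac)
    qed
    have "closure (Q ` V) \<subseteq> {z. a * norm z \<le> norm (S z)}"
      using geS by (intro closure_minimal closed_Collect_le continuous_intros cont) auto
    then show ?thesis using VV[OF x] geT'[OF x] by blast
  qed simp
  then show "a * norm x \<le> norm (T x)" "a * norm x \<le> norm (S x)" by auto
qed

lemma norm_add_orthogonal:
  assumes "inner x y = 0" shows "(norm (x + y))\<^sup>2 = (norm x)\<^sup>2 + (norm y)\<^sup>2"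
  using assms unfolding power2_norm_eq_inner by (simp add: inner_add_left inner_add_right inner_commute)

text \<open>
  The space splits into orthogonal bands on which \<open>|T\<^sup>n|\<close> lies between \<open>(i e)\<^sup>n\<close> and \<open>((i + 1) e)\<^sup>n\<close>.
  They reduce \<open>T\<close>, and both \<open>norm (T x) / norm x\<close> and \<open>norm (S x) / norm x\<close> lie between \<open>i e\<close> and \<open>(i + 1) e\<close> there.
\<close>

lemma norm_adjoint_eq_of_normal_power:
  fixes T S :: "'a::{real_inner,complete_space} \<Rightarrow> 'a"
  assumes T: "adjoint_pair T S" "log_convex_orbits T" and n: "n > 0"
    and normal: "\<And>x. (T ^^ n) ((S ^^ n) x) = (S ^^ n) ((T ^^ n) x)"
  shows "norm (T x) = norm (S x)"
proof -
  define Q where "Q = T ^^ n"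
  define R where "R = S ^^ n"
  have Q: "adjoint_pair Q R" unfolding Q_def R_def by (rule adjoint_pair_funpow[OF T(1)])
  have QR: "Q (R y) = R (Q y)" for y using normal by (simp add: Q_def R_def)
  have TQ: "T (Q y) = Q (T y)" for y by (simp add: Q_def funpow_swap1)
  have lcQ: "log_convex_orbits Q" by (rule normal_log_convex_orbits[OF Q QR])
  define defect where "defect y = (norm (T y))\<^sup>2 - (norm (S y))\<^sup>2" for y
  \<comment> \<open>Induction on the number of bands of width \<open>e\<close>. Orthogonality makes
    the coefficient a maximum over bands rather than a sum; the top band costs
    \<open>((i + 1)^2 - i^2) e^2 = (2 i + 1) e^2\<close>.\<close>
  have bands: "\<bar>defect y\<bar> \<le> 2 * real i * e\<^sup>2 * (norm y)\<^sup>2"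
    if e: "e \<ge> 0" and y: "y \<in> growth_space Q ((real i * e) ^ n)" for e i y
    using y
  proof (induction i arbitrary: y)
    \<comment> \<open>Here the growth rate is 0, so \<open>T ^^ n\<close> vanishes on the space, and
      the root bound with \<open>c = 0\<close> makes \<open>T\<close> and \<open>S\<close> vanish
      too.\<close>
    case 0
    have inv: "S z \<in> growth_space Q ((real 0 * e) ^ n)"
      and "norm ((T ^^ n) z) \<le> 0 ^ n * norm z"
      if z: "z \<in> growth_space Q ((real 0 * e) ^ n)" for z
      using growth_space_commute_adjoint(2)[of Q R T S _ z, OF Q QR T(1) TQ _ z] growth_space_norm_le[OF lcQ _ z]
      by (simp_all add: Q_def)
    then have "norm (T y) \<le> 0 * norm y" "norm (S y) \<le> 0 * norm y"
      using root_norm_le[OF T n order_refl _ _ 0] by blast+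
    then show ?case by (simp add: defect_def)
  next
    case (Suc i)
    define r where "r = (real i * e) ^ n"
    define r' where "r' = (real (Suc i) * e) ^ n"
    have r: "0 \<le> r" "r \<le> r'" "0 \<le> r'"
      using e by (auto simp: r_def r'_def intro!: power_mono mult_right_mono)
    define M where "M = growth_space Q r"
    define M' where "M' = growth_space Q r'"
    have M: "subspace M" "closed M" "subspace M'" "closed M'"
      unfolding M_def M'_def
      by (intro subspace_growth_space closed_growth_space adjoint_pairD[OF Q] lcQ r)+
    have inv: "z \<in> M \<Longrightarrow> T z \<in> M" "z \<in> M \<Longrightarrow> S z \<in> M"
      "z \<in> M' \<Longrightarrow> T z \<in> M'" "z \<in> M' \<Longrightarrow> S z \<in> M'" for z
      using growth_space_commute_adjoint[of Q R T S, OF Q QR T(1) TQ] r by (auto simp: M_def M'_def)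
    have MM': "M \<subseteq> M'"
    proof
      fix z assume "z \<in> M"
      then obtain C where C: "C \<ge> 0" "\<And>k. norm ((Q ^^ k) z) \<le> C * r ^ k"
        unfolding M_def using growth_spaceE r(1) by blast
      have "norm ((Q ^^ k) z) \<le> C * r' ^ k" for k
        using order_trans[OF C(2)[of k] mult_left_mono[OF power_mono[OF r(2,1)] C(1)]] .
      then show "z \<in> M'" unfolding M'_def by (rule growth_spaceI)
    qed
    \<comment> \<open>The new band is the part of \<open>M'\<close> orthogonal to \<open>M\<close>:
      upper bounds come from \<open>M'\<close>, lower bounds from \<open>N\<close>.\<close>
    define N where "N = {z. \<forall>w\<in>M. inner z w = 0}"
    have "subspace N"
      unfolding N_def by (rule subspaceI) (auto simp: inner_add_left)
    have "closed (\<Inter>w\<in>M. {z. inner z w = 0})"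
      by (intro closed_INT ballI closed_Collect_eq continuous_intros)
    moreover have "N = (\<Inter>w\<in>M. {z. inner z w = 0})" unfolding N_def by blast
    ultimately have "closed N" by simp
    have invN: "z \<in> N \<Longrightarrow> T z \<in> N" "z \<in> N \<Longrightarrow> S z \<in> N" for z
      using inv by (auto simp: N_def adjoint_pairD(5,6)[OF T(1)])
    obtain u where u: "u \<in> M" "\<And>w. w \<in> M \<Longrightarrow> inner (y - u) w = 0"
      using orthogonal_decomposition[OF M(1,2), of y] by blast
    define v where "v = y - u"
    have v: "v \<in> N" using u(2) by (simp add: v_def N_def)
    have v': "v \<in> M'"
      unfolding v_def using Suc.prems u(1) MM' M(3) by (auto simp: M'_def r'_def intro: subspace_diff)
    have y: "y = u + v" by (simp add: v_def)
    have nonneg: "0 \<le> real i * e" "0 \<le> real (Suc i) * e" using e by auto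
    have "norm ((T ^^ n) z) \<le> (real (Suc i) * e) ^ n * norm z" if "z \<in> M'" for z
      using growth_space_norm_le[OF lcQ r(3)] that by (simp only: M'_def Q_def r'_def)
    note upper = root_norm_le[OF T n nonneg(2) inv(4) this v']
    have "(real i * e) ^ n * norm z \<le> norm ((T ^^ n) z)" if "z \<in> N" for z
      using growth_space_complement_norm_ge[OF Q QR r(1), of z] that
      by (simp add: N_def M_def Q_def r_def)
    note lower = root_norm_ge[OF T n nonneg(1) normal \<open>subspace N\<close> \<open>closed N\<close> invN this v]
    have "(real i * e * norm v)\<^sup>2 \<le> (norm (T v))\<^sup>2" "(real i * e * norm v)\<^sup>2 \<le> (norm (S v))\<^sup>2"
      using lower e by (auto intro!: power_mono)
    moreover have "(norm (T v))\<^sup>2 \<le> (real (Suc i) * e * norm v)\<^sup>2" "(norm (S v))\<^sup>2 \<le> (real (Suc i) * e * norm v)\<^sup>2"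
      using upper by (auto intro!: power_mono)
    ultimately have "\<bar>defect v\<bar> \<le> (real (Suc i) * e * norm v)\<^sup>2 - (real i * e * norm v)\<^sup>2"
      unfolding defect_def by linarith
    also have "\<dots> = (2 * real i + 1) * e\<^sup>2 * (norm v)\<^sup>2"
      by (simp add: power2_eq_square algebra_simps)
    also have "\<dots> \<le> 2 * real (Suc i) * e\<^sup>2 * (norm v)\<^sup>2"
      by (intro mult_right_mono) auto
    finally have dv: "\<bar>defect v\<bar> \<le> 2 * real (Suc i) * e\<^sup>2 * (norm v)\<^sup>2" .
    have "\<bar>defect u\<bar> \<le> 2 * real i * e\<^sup>2 * (norm u)\<^sup>2"
      using Suc.IH u(1) by (simp add: M_def r_def)
    also have "\<dots> \<le> 2 * real (Suc i) * e\<^sup>2 * (norm u)\<^sup>2"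
      by (intro mult_right_mono) auto
    finally have du: "\<bar>defect u\<bar> \<le> 2 * real (Suc i) * e\<^sup>2 * (norm u)\<^sup>2" .
    \<comment> \<open>\<open>M\<close> and \<open>N\<close> both reduce \<open>T\<close>, so the
      cross terms vanish and the defect is additive.\<close>
    have orth: "inner u v = 0" "inner (T u) (T v) = 0" "inner (S u) (S v) = 0"
      using v invN[OF v] inv(1,2)[OF u(1)] u(1) by (auto simp: N_def inner_commute)
    have "defect y = defect u + defect v"
      unfolding defect_def y
      by (simp add: linear_add[OF adjoint_pairD(3)[OF T(1)]] linear_add[OF adjoint_pairD(4)[OF T(1)]]
          norm_add_orthogonal orth)
    moreover have "(norm y)\<^sup>2 = (norm u)\<^sup>2 + (norm v)\<^sup>2"
      unfolding y by (rule norm_add_orthogonal[OF orth(1)])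
    ultimately show ?case using du dv by (simp add: distrib_left)
  qed
  obtain K where K: "K \<ge> 0" "\<And>x. norm (T x) \<le> norm x * K"
    using bounded_linear.nonneg_bounded[OF adjoint_pairD(1)[OF T(1)]] by blast
  have pow: "norm ((T ^^ k) x) \<le> norm x * K ^ k" for k
  proof (induction k)
    case (Suc k)
    show ?case using order_trans[OF K(2)[of "(T ^^ k) x"] mult_right_mono[OF Suc K(1)]]
      by (simp add: mult_ac)
  qed simp
  \<comment> \<open>\<open>Q ^^ k\<close> is \<open>T ^^ (n * k)\<close>, which is bounded by the
    matching power of \<open>K\<close>.\<close>
  have whole: "x \<in> growth_space Q (K ^ n)"
    by (rule growth_spaceI[of _ _ "norm x"]) (simp add: Q_def pow funpow_mult mult.commute flip: power_mult)
  have small: "\<bar>defect x\<bar> \<le> 2 * K\<^sup>2 * (norm x)\<^sup>2 * inverse (real (Suc m))" for m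
  proof -
    \<comment> \<open>\<open>Suc m\<close> bands of width \<open>K / real (Suc m)\<close> exactly
      cover the range from 0 to \<open>K\<close>.\<close>
    have "\<bar>defect x\<bar> \<le> 2 * real (Suc m) * (K / real (Suc m))\<^sup>2 * (norm x)\<^sup>2"
      by (rule bands) (use K(1) whole in \<open>auto simp del: of_nat_Suc\<close>)
    also have "\<dots> = 2 * K\<^sup>2 * (norm x)\<^sup>2 * inverse (real (Suc m))"
      by (simp add: power2_eq_square field_simps del: of_nat_Suc)
    finally show ?thesis .
  qed
  have "(\<lambda>m. 2 * K\<^sup>2 * (norm x)\<^sup>2 * inverse (real (Suc m))) \<longlonglongrightarrow> 2 * K\<^sup>2 * (norm x)\<^sup>2 * 0"
    by (intro tendsto_intros LIMSEQ_inverse_real_of_nat)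
  then have "\<bar>defect x\<bar> \<le> 2 * K\<^sup>2 * (norm x)\<^sup>2 * 0"
    by (rule LIMSEQ_le_const) (use small in blast)
  then have "(norm (T x))\<^sup>2 = (norm (S x))\<^sup>2" by (simp add: defect_def)
  then show ?thesis by (simp add: power2_eq_iff_nonneg)
qed

section \<open>From equal norms, and from quasinormality, to normality\<close>

text \<open>Polarization turns equal norms into \<open><T x, T y> = <S x, S y>\<close>.\<close>

lemma normal_of_norm_adjoint_eq:
  assumes T: "adjoint_pair T S" and norm: "\<And>x. norm (T x) = norm (S x)"
  shows "T (S x) = S (T x)"
proof -
  note lin = linear_add[OF adjoint_pairD(3)[OF T]] linear_add[OF adjoint_pairD(4)[OF T]]
  have "inner (T x) (T y) = inner (S x) (S y)" for x y
    using norm[of "x + y"] norm[of x] norm[of y] by (simp only: dot_norm lin)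
  then have "inner y (S (T x) - T (S x)) = 0" for y
    by (simp add: inner_diff_right flip: adjoint_pairD(5,6)[OF T])
  then have "S (T x) - T (S x) = 0" using inner_eq_zero_iff by blast
  then show ?thesis by simp
qed

text \<open>Powers of \<open>S\<close> gain no kernel: \<open>S (S x) = 0\<close> implies
  \<open>T (S x) = 0\<close> by \<open>ker\<close>, whence
  \<open>|S x|^2 = <x, T (S x)> = 0\<close>.\<close>

lemma funpow_adjoint_kernel:
  assumes T: "adjoint_pair T S" and ker: "\<And>x. S x = 0 \<Longrightarrow> T x = 0"
  shows "(S ^^ k) x = 0 \<Longrightarrow> k > 0 \<Longrightarrow> S x = 0"
proof (induction k arbitrary: x)
  case (Suc k)
  show ?case
  proof (cases "k = 0")
    case False
    then have "S (S x) = 0" using Suc by (simp add: funpow_swap1)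
    then have "T (S x) = 0" by (rule ker)
    then have "inner (S x) (S x) = 0" by (simp add: adjoint_pairD(6)[OF T])
    then show ?thesis by simp
  qed (use Suc in simp)
qed simp

lemma normal_of_quasinormal_kernel:
  assumes Q: "adjoint_pair Q R" and quasi: "\<And>x. R (Q (Q x)) = Q (R (Q x))"
    and ker: "\<And>x. R x = 0 \<Longrightarrow> Q x = 0"
  shows "Q (R x) = R (Q x)"
proof -
  define C where "C y = R (Q y) - Q (R y)" for y
  \<comment> \<open>Symmetry of \<open>C\<close> is used twice: it turns \<open>C Q = 0\<close> into
    \<open>R C = 0\<close>, and \<open>C C = 0\<close> into \<open>C = 0\<close>.\<close>
  have sym: "inner (C y) z = inner y (C z)" for y z
    by (simp add: C_def inner_diff_left inner_diff_right adjoint_pairD(5,6)[OF Q])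
  have CQ: "C (Q y) = 0" for y by (simp add: C_def quasi)
  have "inner y (R (C x)) = 0" for y
  proof -
    have "inner y (R (C x)) = inner (C (Q y)) x" by (simp add: sym adjoint_pairD(5)[OF Q, symmetric])
    then show ?thesis by (simp add: CQ)
  qed
  then have RC: "R (C x) = 0" using inner_eq_zero_iff by blast
  then have "Q (C x) = 0" by (rule ker)
  then have "C (C x) = 0"
    using RC by (subst C_def) (simp add: linear_0[OF adjoint_pairD(3)[OF Q]] linear_0[OF adjoint_pairD(4)[OF Q]])
  then have "inner (C x) (C x) = 0" by (simp add: sym)
  then show ?thesis by (simp add: C_def)
qed

lemma paranormal_root_normal:
  fixes T S :: "'a::{real_inner,complete_space} \<Rightarrow> 'a"
  assumes T: "adjoint_pair T S" "log_convex_orbits T" and n: "n > 0"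
    and ker: "\<And>x. S x = 0 \<Longrightarrow> T x = 0"
    and quasi: "\<And>x. (S ^^ n) ((T ^^ n) ((T ^^ n) x)) = (T ^^ n) ((S ^^ n) ((T ^^ n) x))"
  shows "T (S x) = S (T x)"
proof -
  \<comment> \<open>Kernel inclusions: from \<open>S ^^ n\<close> to \<open>S\<close>, to
    \<open>T\<close>, to \<open>T ^^ n\<close>.\<close>
  have "(T ^^ n) y = 0" if "(S ^^ n) y = 0" for y
  proof -
    have "T y = 0" using funpow_adjoint_kernel[OF T(1) ker that n] by (rule ker)
    then have "(T ^^ (n - 1)) (T y) = 0"
      using linear_0[OF adjoint_pairD(3)[OF adjoint_pair_funpow[OF T(1)]]] by simp
    then show ?thesis using n by (cases n) (simp_all add: funpow_swap1)
  qed
  then have "(T ^^ n) ((S ^^ n) y) = (S ^^ n) ((T ^^ n) y)" for y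
    by (rule normal_of_quasinormal_kernel[OF adjoint_pair_funpow[OF T(1)] quasi])
  then show ?thesis
    using normal_of_norm_adjoint_eq[OF T(1)] norm_adjoint_eq_of_normal_power[OF T n] by blast
qed

subsection \<open>The real Hilbert space underlying a complex one\<close>

text \<open>The class \<open>complex_hilbert\<close> does not extend \<open>real_inner\<close>. This
  copy of the type carries the real inner product \<open>Re (cinner x y)\<close> with the same
  norm.\<close>

typedef 'a realified = "UNIV :: 'a set"
  morphisms complexify realify by simp

setup_lifting type_definition_realified

lemma complexify_realify [simp]: "complexify (realify x) = x"
  by (simp add: realify_inverse)

instantiation realified :: (complex_hilbert) real_vector
begin

lift_definition zero_realified :: "'a realified" is 0 .
lift_definition plus_realified :: "'a realified \<Rightarrow> 'a realified \<Rightarrow> 'a realified" is "(+)" .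
lift_definition minus_realified :: "'a realified \<Rightarrow> 'a realified \<Rightarrow> 'a realified" is "(-)" .
lift_definition uminus_realified :: "'a realified \<Rightarrow> 'a realified" is uminus .
lift_definition scaleR_realified :: "real \<Rightarrow> 'a realified \<Rightarrow> 'a realified" is scaleR .

instance
  by standard (transfer; simp add: algebra_simps)+

end

text \<open>\<open>sqrt\<close> is odd on the reals, so nonnegativity of the norm forces
  \<open>Re (cinner x x)\<close> to be nonnegative.\<close>

lemma Re_cinner_self: "Re (cinner x x) = (norm x)\<^sup>2" for x :: "'a::complex_hilbert"
proof -
  have "0 \<le> sqrt (Re (cinner x x))" using norm_ge_zero[of x] by (simp only: norm_eq_sqrt_cinner)
  then show ?thesis by (simp add: norm_eq_sqrt_cinner)
qed

instantiation realified :: (complex_hilbert) real_inner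
begin

lift_definition inner_realified :: "'a realified \<Rightarrow> 'a realified \<Rightarrow> real"
  is "\<lambda>x y. Re (cinner x y)" .
lift_definition norm_realified :: "'a realified \<Rightarrow> real" is norm .
definition dist_realified :: "'a realified \<Rightarrow> 'a realified \<Rightarrow> real"
  where "dist_realified x y = norm (x - y)"
definition sgn_realified :: "'a realified \<Rightarrow> 'a realified"
  where "sgn_realified x = inverse (norm x) *\<^sub>R x"
definition uniformity_realified :: "('a realified \<times> 'a realified) filter"
  where "uniformity_realified = (INF e\<in>{0<..}. principal {(x, y). dist x y < e})"
definition open_realified :: "'a realified set \<Rightarrow> bool"
  where "open_realified U \<longleftrightarrow> (\<forall>x\<in>U. \<forall>\<^sub>F (x', y) in uniformity. x' = x \<longrightarrow> y \<in> U)"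

instance
proof
  fix x y z :: "'a realified" and r :: real and U :: "'a realified set"
  show "dist x y = norm (x - y)" by (rule dist_realified_def)
  show "sgn x = inverse (norm x) *\<^sub>R x" by (rule sgn_realified_def)
  show "uniformity = (INF e\<in>{0<..}. principal {(x::'a realified, y). dist x y < e})"
    by (rule uniformity_realified_def)
  show "open U \<longleftrightarrow> (\<forall>x\<in>U. \<forall>\<^sub>F (x', y) in uniformity. x' = x \<longrightarrow> y \<in> U)"
    by (rule open_realified_def)
  show sym: "inner x y = inner y x" for x y :: "'a realified"
    by transfer (metis cinner_commute complex_cnj(1) cnj.sel(1))
  \<comment> \<open>The complex axioms give linearity in the second argument; symmetry moves it to
    the first.\<close>
  have "inner z (x + y) = inner z x + inner z y" by transfer (simp add: cinner_add_right)
  then show "inner (x + y) z = inner x z + inner y z" by (simp only: sym)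
  have "inner y (r *\<^sub>R x) = r * inner y x"
    by transfer (simp add: scaleR_scaleC cinner_scaleC_right)
  then show "inner (r *\<^sub>R x) y = r * inner x y" by (simp only: sym)
  show "0 \<le> inner x x" by transfer (simp add: Re_cinner_self)
  show "inner x x = 0 \<longleftrightarrow> x = 0" by transfer (simp add: Re_cinner_self)
  show "norm x = sqrt (inner x x)" by transfer (rule norm_eq_sqrt_cinner)
qed

end

instance realified :: (complex_hilbert) complete_space
proof
  have dist: "dist x y = dist (complexify x) (complexify y)" for x y :: "'a realified"
    by (simp add: dist_norm norm_realified.rep_eq minus_realified.rep_eq)
  fix X :: "nat \<Rightarrow> 'a realified" assume "Cauchy X"
  then have "Cauchy (\<lambda>n. complexify (X n))" by (simp add: Cauchy_def dist)
  then obtain l where "(\<lambda>n. complexify (X n)) \<longlonglongrightarrow> l"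
    using Cauchy_convergent convergent_def by blast
  then have "X \<longlonglongrightarrow> realify l" by (simp add: tendsto_iff dist)
  then show "convergent X" by (rule convergentI)
qed

theorem theorem5p4:
  fixes T Tadj :: "'a::complex_hilbert \<Rightarrow> 'a" and n :: nat
  assumes "bounded_clinear_op T"
    and "is_adjoint T Tadj"
    and "coquasiposinormal T Tadj"
    and "paranormal T"
    and "n > 0"
    and "quasinormal (T ^^ n) (Tadj ^^ n)"
  shows "normal_op T Tadj"
proof -
  \<comment> \<open>Conjugation by the type copy preserves powers, kernels, norms and the adjoint
    relation, so every hypothesis transfers.\<close>
  define T' S' where "T' = realify \<circ> T \<circ> complexify" and "S' = realify \<circ> Tadj \<circ> complexify"
  note norm = norm_realified.rep_eq
  obtain K where K: "\<And>x. norm (T x) \<le> norm x * K"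
    using assms(1) unfolding bounded_clinear_op_def by blast
  have T': "bounded_linear T'"
  proof (rule bounded_linear_intro[of _ K])
    show "T' (x + y) = T' x + T' y" for x y
      using assms(1) by (simp add: T'_def bounded_clinear_op_def plus_realified.rep_eq plus_realified.abs_eq)
    show "T' (r *\<^sub>R x) = r *\<^sub>R T' x" for r x
      using assms(1)
      by (simp add: T'_def bounded_clinear_op_def scaleR_realified.rep_eq scaleR_realified.abs_eq scaleR_scaleC)
    show "norm (T' x) \<le> norm x * K" for x using K by (simp add: T'_def norm)
  qed
  have adj: "inner (T' x) y = inner x (S' y)" for x y
    using assms(2) by (simp add: T'_def S'_def inner_realified.rep_eq is_adjoint_def)
  have pair: "adjoint_pair T' S'" by (rule adjoint_pairI[OF T' adj])
  have powT: "complexify ((T' ^^ k) (realify x)) = (T ^^ k) x" for k x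
    by (induction k) (simp_all add: T'_def)
  have powS: "complexify ((S' ^^ k) (realify x)) = (Tadj ^^ k) x" for k x
    by (induction k) (simp_all add: S'_def)
  have T'k: "(T' ^^ k) x = realify ((T ^^ k) (complexify x))"
    and S'k: "(S' ^^ k) x = realify ((Tadj ^^ k) (complexify x))" for k x
    by (metis complexify_inverse powT, metis complexify_inverse powS)
  have "T' (S' x) = S' (T' x)" for x
  proof (rule paranormal_root_normal[OF pair _ assms(5)])
    show "log_convex_orbits T'"
      using assms(4) by (simp add: log_convex_orbits_def paranormal_def T'_def norm)
    show "T' x = 0" if "S' x = 0" for x
    proof -
      have "Tadj (complexify x) = 0"
        using arg_cong[OF that, of complexify] by (simp add: S'_def zero_realified.rep_eq)
      then have "T (complexify x) = 0" using assms(3) by (auto simp: coquasiposinormal_def)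
      then show ?thesis by (simp add: T'_def zero_realified.abs_eq)
    qed
    show "(S' ^^ n) ((T' ^^ n) ((T' ^^ n) x)) = (T' ^^ n) ((S' ^^ n) ((T' ^^ n) x))" for x
      using assms(6) by (simp add: T'k S'k quasinormal_def)
  qed
  from arg_cong[OF this, of complexify "realify _"] show ?thesis
    unfolding normal_op_def by (simp add: T'_def S'_def)
qed

end
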